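(* Let $n\ge 2$ be an integer. For every positive rational number $q$ there exists a positive integer $r$ such that $$(-1)^r\sum_{j=1}^{r}(-q)^j\,B_{r,j}\big(x_1,x_2,\dots,x_{r-j+1}\big)<0,$$ where $x_l=\frac1l\prod_{s=1}^{l-1}(ns-1)$ for $l\ge 1$ (so $x_1=1$, $x_2=\frac{n-1}{2}$, $x_3=\frac{(n-1)(2n-1)}{3}$, and so on), and $B_{r,j}$ are the partial exponential Bell polynomials.
   Context: The partial (exponential) Bell polynomials are $$B_{r,j}(x_1,\dots,x_{r-j+1})=\sum\frac{r!}{s_1!\cdots s_{r-j+1}!}\left(\frac{x_1}{1!}\right)^{s_1}\left(\frac{x_2}{2!}\right)^{s_2}\cdots\left(\frac{x_{r-j+1}}{(r-j+1)!}\right)^{s_{r-j+1}},$$ where the sum is over all nonnegative integers $s_1,\dots,s_{r-j+1}$ with $s_1+2s_2+\cdots+(r-j+1)s_{r-j+1}=r$ and $s_1+\cdots+s_{r-j+1}=j$. An empty product equals $1$. *)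

theory Defs
  imports Complex_Main "HOL-Library.FuncSet"
begin

text \<open>
  Exponent vectors \<open>(s\<^sub>1, \<dots>, s\<^sub>m)\<close>, where \<open>m = r - j + 1\<close>, are extensional functions
  on \<open>{1..m}\<close>, so each vector is represented by exactly one function. The truncated
  subtraction is harmless: for \<open>j > r\<close> the set is empty.
\<close>

definition bell_exponents :: "nat \<Rightarrow> nat \<Rightarrow> (nat \<Rightarrow> nat) set" where
  "bell_exponents r j =
     {s \<in> {1..r - j + 1} \<rightarrow>\<^sub>E UNIV.
        (\<Sum>i=1..r - j + 1. i * s i) = r \<and> (\<Sum>i=1..r - j + 1. s i) = j}"

lemma finite_bell_exponents: "finite (bell_exponents r j)"
proof (rule finite_subset)
  show "bell_exponents r j \<subseteq> {1..r - j + 1} \<rightarrow>\<^sub>E {..j}"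
  proof
    fix s assume s: "s \<in> bell_exponents r j"
    have "s i \<le> j" if "i \<in> {1..r - j + 1}" for i
      using s member_le_sum[OF that, of s] by (simp add: bell_exponents_def)
    with s show "s \<in> {1..r - j + 1} \<rightarrow>\<^sub>E {..j}"
      by (auto simp: bell_exponents_def PiE_iff)
  qed
qed (simp add: finite_PiE)

definition partial_bell :: "nat \<Rightarrow> nat \<Rightarrow> (nat \<Rightarrow> 'a) \<Rightarrow> 'a :: field_char_0" where
  "partial_bell r j x =
     (\<Sum>s\<in>bell_exponents r j.
        fact r / (\<Prod>i=1..r - j + 1. fact (s i)) *
        (\<Prod>i=1..r - j + 1. (x i / fact i) ^ s i))"

definition bell_arg :: "int \<Rightarrow> nat \<Rightarrow> rat" where
  "bell_arg n l = 1 / of_nat l * (\<Prod>s=1..<l. of_int n * of_nat s - 1)"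

end

theory Submission
  imports Defs "HOL-Complex_Analysis.Complex_Analysis"
begin

text \<open>
  Write \<open>N\<close> for \<open>n\<close> and let \<open>F\<close> be the power series with coefficients
  \<open>g\<^sub>r = (-1)\<^sup>r / r! * (\<Sum>j=1..r. (-q)\<^sup>j * B\<^sub>r\<^sub>,\<^sub>j(x))\<close> and \<open>g\<^sub>0 = 1\<close>. By the exponential
  formula, \<open>F(t) = exp (-q * X(-t))\<close> with \<open>X(t) = (\<Sum>l. x\<^sub>l * t^l / l!)\<close>. The numbers \<open>x\<^sub>l\<close> are
  such that \<open>t * X'(t) = 1 - (1 - N t)^(1/N)\<close>, so \<open>F\<close> solves
  \<open>t * F' = q * ((1 + N t)^(1/N) - 1) * F\<close>. Adding \<open>q * F\<close> and raising to the \<open>N\<close>-th power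
  removes the root:
    \<open>(t F' + q F)^N = q^N * (1 + N t) * F^N\<close>.      (1)

  Analytically, the claim follows from Pringsheim's theorem: \<open>F\<close> is singular at the branch
  point \<open>-1/N\<close> but at no point of the positive real axis, whereas a series with nonnegative
  coefficients and finite radius of convergence is singular at a point of the positive real axis.
  Equation (1) gives a direct proof. Suppose that all \<open>g\<^sub>r\<close> are nonnegative. By
  \<open>(A + B)^N \<ge> B^N + N * A * B^(N-1)\<close>, valid coefficientwise for nonnegative \<open>A\<close> and \<open>B\<close>, the left
  side of (1) dominates \<open>q^N * F^N + q^(N-1) * t * (F^N)'\<close>. The coefficients \<open>u\<^sub>m\<close> of \<open>F^N\<close> therefore
  satisfy \<open>m * u\<^sub>m \<le> N * q * u\<^sub>m\<^sub>-\<^sub>1\<close>, so that \<open>g\<^sub>m \<le> u\<^sub>m \<le> (N q)^m / m!\<close>, and \<open>F\<close> is entire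
  (lemma \<open>nonneg_solution_bound\<close>). But then (1) is an identity of entire functions, and comparing
  orders of vanishing at \<open>-1/N\<close> shows that \<open>N\<close> divides \<open>1\<close>, which contradicts \<open>N \<ge> 2\<close>
  (lemma \<open>no_entire_solution\<close>).

  The exponential formula enters only through the recurrence
  \<open>r * T\<^sub>r = (\<Sum>i=1..r. i * c\<^sub>i * T\<^sub>r\<^sub>-\<^sub>i)\<close>, the coefficient form of \<open>t * (exp C)' = (t * C') * exp C\<close>,
  which has a bijective proof (lemma \<open>weighted_partitions_rec\<close>).
\<close>

section \<open>Bell polynomials as sums over partitions\<close>

text \<open>
  Partitions of \<open>r\<close>, given by the multiplicity \<open>s i\<close> of each part \<open>i\<close>. In contrast to
  \<^const>\<open>bell_exponents\<close>, the vectors are total functions that vanish off \<open>{1..r}\<close>, so partitions of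
  different numbers, and with different numbers of parts, live in the same space and can be
  mapped to each other by changing a single entry.
\<close>

definition multiplicities :: "nat \<Rightarrow> (nat \<Rightarrow> nat) set" where
  "multiplicities r = {s. s 0 = 0 \<and> (\<forall>i>r. s i = 0) \<and> (\<Sum>i=1..r. i * s i) = r}"

text \<open>
  The coefficient of \<open>t^r\<close> in \<open>exp (\<Sum>i\<ge>1. c i * t^i)\<close>.
\<close>
definition weighted_partitions :: "(nat \<Rightarrow> 'a :: field_char_0) \<Rightarrow> nat \<Rightarrow> 'a" where
  "weighted_partitions c r = (\<Sum>s\<in>multiplicities r. \<Prod>i=1..r. c i ^ s i / fact (s i))"

text \<open>
  The index range can be enlarged freely: a part \<open>i > r\<close> with \<open>s i > 0\<close> would contribute more
  than \<open>r\<close> to the sum. This puts the partitions of \<open>r\<close> and of \<open>r - i\<close> on the same range.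
\<close>
lemma multiplicities_iff:
  assumes "r \<le> N"
  shows "s \<in> multiplicities r \<longleftrightarrow> s 0 = 0 \<and> (\<forall>i>N. s i = 0) \<and> (\<Sum>i=1..N. i * s i) = r"
proof -
  have split: "(\<Sum>i=1..N. i * s i) = (\<Sum>i=1..r. i * s i)" if "\<forall>i>r. s i = 0"
    using assms that by (intro sum.mono_neutral_right) auto
  have "\<forall>i>r. s i = 0" if "\<forall>i>N. s i = 0" "(\<Sum>i=1..N. i * s i) = r"
  proof (intro allI impI)
    fix i assume "i > r"
    show "s i = 0"
    proof (cases "i \<le> N")
      case True
      with \<open>i > r\<close> have "i * s i \<le> r"
        using that(2) member_le_sum[of i "{1..N}" "\<lambda>i. i * s i"] by auto
      with \<open>i > r\<close> show ?thesis
        by (cases "s i") auto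
    qed (use that in auto)
  qed
  moreover have "\<forall>i>N. s i = 0" if "\<forall>i>r. s i = 0"
    using assms that by simp
  ultimately show ?thesis
    unfolding multiplicities_def mem_Collect_eq using split by metis
qed

lemma weight_extend:
  assumes "r \<le> N" "s \<in> multiplicities r"
  shows "(\<Prod>i=1..r. c i ^ s i / fact (s i)) = (\<Prod>i=1..N. c i ^ s i / fact (s i) :: 'a :: field_char_0)"
  using assms by (intro prod.mono_neutral_left) (auto simp: multiplicities_def)

lemma finite_multiplicities: "finite (multiplicities r)"
proof (rule finite_subset)
  show "multiplicities r \<subseteq> {s. \<forall>i. (i \<in> {..r} \<longrightarrow> s i \<in> {..r}) \<and> (i \<notin> {..r} \<longrightarrow> s i = 0)}"
  proof
    fix s assume s: "s \<in> multiplicities r"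
    have "s i \<le> r" if "i \<le> r" for i
    proof (cases "i = 0")
      case False
      with \<open>i \<le> r\<close> have "i * s i \<le> r"
        using s member_le_sum[of i "{1..r}" "\<lambda>i. i * s i"] by (auto simp: multiplicities_def)
      with False show ?thesis
        by (cases i) auto
    qed (use s in \<open>auto simp: multiplicities_def\<close>)
    with s show "s \<in> {s. \<forall>i. (i \<in> {..r} \<longrightarrow> s i \<in> {..r}) \<and> (i \<notin> {..r} \<longrightarrow> s i = 0)}"
      by (auto simp: multiplicities_def)
  qed
  show "finite {s. \<forall>i. (i \<in> {..r} \<longrightarrow> s i \<in> {..r}) \<and> (i \<notin> {..r} \<longrightarrow> s i = (0::nat))}"
    by (rule finite_set_of_finite_funs) auto
qed

text \<open>
  Removing one copy of the part \<open>i\<close> is a bijection from the partitions of \<open>r\<close> that contain \<open>i\<close> to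
  the partitions of \<open>r - i\<close>. The weight loses one factor \<open>c i / s i\<close>, which absorbs the factor \<open>s i\<close>.
\<close>
lemma weighted_partitions_remove:
  fixes c :: "nat \<Rightarrow> 'a :: field_char_0"
  assumes i: "i \<in> {1..r}"
  shows "(\<Sum>s\<in>multiplicities r. of_nat (s i) * (\<Prod>k=1..r. c k ^ s k / fact (s k)))
           = c i * weighted_partitions c (r - i)"
proof -
  let ?w = "\<lambda>s. \<Prod>k=1..r. c k ^ s k / fact (s k)"
  have sum_upd: "(\<Sum>k=1..r. k * (s(i := v)) k) = i * v + (\<Sum>k\<in>{1..r} - {i}. k * s k)" for s v
  proof -
    have "(\<Sum>k=1..r. k * (s(i := v)) k) = i * v + (\<Sum>k\<in>{1..r} - {i}. k * (s(i := v)) k)"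
      using i by (subst sum.remove[of _ i]) auto
    also have "(\<Sum>k\<in>{1..r} - {i}. k * (s(i := v)) k) = (\<Sum>k\<in>{1..r} - {i}. k * s k)"
      by (intro sum.cong) auto
    finally show ?thesis .
  qed
  have sum_id: "(\<Sum>k=1..r. k * s k) = i * s i + (\<Sum>k\<in>{1..r} - {i}. k * s k)" for s
    using sum_upd[of s "s i"] by simp
  have "(\<Sum>s\<in>multiplicities r. of_nat (s i) * ?w s)
          = (\<Sum>s\<in>{s\<in>multiplicities r. s i > 0}. of_nat (s i) * ?w s)"
    by (intro sum.mono_neutral_right) (auto simp: finite_multiplicities)
  also have "\<dots> = (\<Sum>s\<in>multiplicities (r - i). c i * ?w s)"
  proof (rule sum.reindex_bij_witness[of _ "\<lambda>s. s(i := s i + 1)" "\<lambda>s. s(i := s i - 1)"])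
    fix s assume s: "s \<in> {s\<in>multiplicities r. s i > 0}"
    then obtain m where m: "s i = Suc m"
      by (auto simp: gr0_conv_Suc)
    show "s(i := s i - 1, i := (s(i := s i - 1)) i + 1) = s"
      using s by auto
    from s sum_id[of s] have "i * s i + (\<Sum>k\<in>{1..r} - {i}. k * s k) = r"
      by (auto simp: multiplicities_def)
    hence "(\<Sum>k=1..r. k * (s(i := s i - 1)) k) = r - i"
      unfolding sum_upd by (simp add: m algebra_simps)
    with i s show "s(i := s i - 1) \<in> multiplicities (r - i)"
      unfolding multiplicities_iff[OF diff_le_self] by (auto simp: multiplicities_def)
    let ?rest = "\<Prod>k\<in>{1..r} - {i}. c k ^ s k / fact (s k)"
    have "?w (s(i := s i - 1)) = (c i ^ m / fact m) * ?rest"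
      using i m by (subst prod.remove[of _ i]) auto
    moreover have "?w s = (c i ^ Suc m / fact (Suc m)) * ?rest"
      using i m by (subst prod.remove[of _ i]) auto
    moreover have "c i * (c i ^ m / fact m) = of_nat (s i) * (c i ^ Suc m / fact (Suc m))"
      using of_nat_neq_0[of m, where 'a = 'a] by (simp add: m field_simps del: of_nat_Suc)
    ultimately show "c i * ?w (s(i := s i - 1)) = of_nat (s i) * ?w s"
      by (simp only: mult.assoc[symmetric])
  next
    fix s assume s: "s \<in> multiplicities (r - i)"
    show "s(i := s i + 1, i := (s(i := s i + 1)) i - 1) = s"
      by auto
    from s have *: "s 0 = 0" "\<forall>k>r. s k = 0" "(\<Sum>k=1..r. k * s k) = r - i"
      by (subst (asm) multiplicities_iff[of _ r]; simp)+
    have "i \<le> r"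
      using i by simp
    with *(3) sum_id[of s] have "(\<Sum>k=1..r. k * (s(i := s i + 1)) k) = r"
      unfolding sum_upd distrib_left by linarith
    with * i show "s(i := s i + 1) \<in> {s\<in>multiplicities r. s i > 0}"
      unfolding multiplicities_def by auto
  qed
  also have "\<dots> = c i * weighted_partitions c (r - i)"
    unfolding weighted_partitions_def sum_distrib_left
    by (intro sum.cong) (simp_all only: weight_extend[OF diff_le_self])
  finally show ?thesis .
qed

text \<open>
  Expand the factor \<open>r\<close> as \<open>\<Sum>i. i * s i\<close> inside the sum over all \<open>s\<close>, exchange the sums, and
  remove a part \<open>i\<close>.
\<close>
lemma weighted_partitions_rec:
  fixes c :: "nat \<Rightarrow> 'a :: field_char_0"
  shows "of_nat r * weighted_partitions c r
           = (\<Sum>i=1..r. of_nat i * c i * weighted_partitions c (r - i))"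
proof -
  let ?w = "\<lambda>s. \<Prod>k=1..r. c k ^ s k / fact (s k)"
  have "of_nat r * weighted_partitions c r
          = (\<Sum>s\<in>multiplicities r. of_nat (\<Sum>i=1..r. i * s i) * ?w s)"
    unfolding weighted_partitions_def sum_distrib_left
    by (intro sum.cong) (auto simp: multiplicities_def)
  also have "\<dots> = (\<Sum>i=1..r. of_nat i * (\<Sum>s\<in>multiplicities r. of_nat (s i) * ?w s))"
    unfolding of_nat_sum sum_distrib_left sum_distrib_right of_nat_mult mult.assoc
    by (rule sum.swap)
  also have "\<dots> = (\<Sum>i=1..r. of_nat i * c i * weighted_partitions c (r - i))"
    by (intro sum.cong) (simp_all only: weighted_partitions_remove mult.assoc)
  finally show ?thesis .
qed

lemma weighted_partitions_0: "weighted_partitions c 0 = 1"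
proof -
  have "multiplicities 0 = {\<lambda>_. 0}"
    unfolding multiplicities_def by (auto simp: fun_eq_iff) (metis gr0I)
  thus ?thesis
    by (simp add: weighted_partitions_def)
qed

text \<open>
  The largest part of a partition of \<open>r\<close> into \<open>j\<close> parts is at most \<open>r - j + 1\<close>, as each of the other
  \<open>j - 1\<close> parts is at least \<open>1\<close>. Hence the variables on which \<open>B\<^sub>r\<^sub>,\<^sub>j\<close> depends are the only ones
  that matter.
\<close>
lemma multiplicities_parts_bound:
  assumes "s \<in> multiplicities r" "i > r - (\<Sum>k=1..r. s k) + 1"
  shows "s i = 0"
proof (rule ccontr)
  assume "s i \<noteq> 0"
  with assms(1) have "i \<noteq> 0" "\<not> i > r"
    by (auto simp: multiplicities_def intro: gr0I)
  hence i: "i \<in> {1..r}"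
    by auto
  from \<open>s i \<noteq> 0\<close> have "s i + (i - 1) \<le> i * s i"
    using i by (cases i; cases "s i") auto
  moreover have "(\<Sum>k\<in>{1..r} - {i}. s k) \<le> (\<Sum>k\<in>{1..r} - {i}. k * s k)"
    by (intro sum_mono) auto
  ultimately have "(\<Sum>k=1..r. s k) + (i - 1) \<le> (\<Sum>k=1..r. k * s k)"
    using i by (simp add: sum.remove[of _ i])
  with assms i show False
    by (auto simp: multiplicities_def)
qed

lemma partial_bell_as_multiplicities:
  fixes x :: "nat \<Rightarrow> 'a :: field_char_0"
  assumes j: "j \<in> {1..r}"
  shows "y ^ j * partial_bell r j x =
    fact r * (\<Sum>s | s \<in> multiplicities r \<and> (\<Sum>i=1..r. s i) = j.
                \<Prod>i=1..r. (y * x i / fact i) ^ s i / fact (s i))"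
proof -
  \<comment> \<open>Restriction to \<open>{1..m}\<close> and extension by zero identify the two kinds of exponent vectors.\<close>
  define m where "m = r - j + 1"
  have m: "m \<le> r" using j by (auto simp: m_def)
  let ?A = "{s \<in> multiplicities r. (\<Sum>i=1..r. s i) = j}"
  let ?ext = "\<lambda>s i. if i \<in> {1..m} then s i else (0::nat)"
  let ?res = "\<lambda>s. restrict s {1..m}"
  have zero: "s i = 0" if "s \<in> ?A" "i > m" for s i
    using that multiplicities_parts_bound[of s r i] by (auto simp: m_def)
  have sum_short: "(\<Sum>i=1..r. f i) = (\<Sum>i=1..m. f i :: nat)" if "\<And>i. i > m \<Longrightarrow> f i = 0" for f
    using m that by (intro sum.mono_neutral_right) auto
  have "y ^ j * partial_bell r j x = (\<Sum>s\<in>bell_exponents r j.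
          fact r * (\<Prod>i=1..m. (y * x i / fact i) ^ s i / fact (s i)))"
    unfolding partial_bell_def sum_distrib_left m_def[symmetric]
  proof (rule sum.cong)
    fix s assume "s \<in> bell_exponents r j"
    hence "(\<Sum>i=1..m. s i) = j"
      by (auto simp: bell_exponents_def m_def)
    hence "y ^ j = (\<Prod>i=1..m. y ^ s i)"
      by (simp flip: power_sum)
    thus "y ^ j * (fact r / (\<Prod>i=1..m. fact (s i)) * (\<Prod>i=1..m. (x i / fact i) ^ s i)) =
          fact r * (\<Prod>i=1..m. (y * x i / fact i) ^ s i / fact (s i))"
      by (simp add: prod_dividef prod.distrib power_divide power_mult_distrib mult_ac)
  qed simp
  also have "\<dots> = (\<Sum>s\<in>?A. fact r * (\<Prod>i=1..r. (y * x i / fact i) ^ s i / fact (s i)))"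
  proof (rule sum.reindex_bij_witness[of _ ?res ?ext])
    fix s assume "s \<in> bell_exponents r j"
    hence s: "s \<in> {1..m} \<rightarrow>\<^sub>E UNIV" "(\<Sum>i=1..m. i * s i) = r" "(\<Sum>i=1..m. s i) = j"
      by (auto simp: bell_exponents_def m_def)
    show "?res (?ext s) = s"
      using s(1) by (auto simp: fun_eq_iff PiE_def extensional_def)
    have "(\<Sum>i=1..r. i * ?ext s i) = r" "(\<Sum>i=1..r. ?ext s i) = j"
      using s by (subst sum_short; force)+
    thus "?ext s \<in> ?A"
      using m by (auto simp: multiplicities_def)
    show "fact r * (\<Prod>i=1..r. (y * x i / fact i) ^ ?ext s i / fact (?ext s i)) =
          fact r * (\<Prod>i=1..m. (y * x i / fact i) ^ s i / fact (s i))"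
      using m by (intro arg_cong2[of _ _ _ _ "(*)"] refl prod.mono_neutral_cong_right) auto
  next
    fix s assume s: "s \<in> ?A"
    show "?ext (?res s) = s"
      using s zero[OF s] by (auto simp: fun_eq_iff multiplicities_def not_le Suc_le_eq)
    have "(\<Sum>i=1..m. i * s i) = r" "(\<Sum>i=1..m. s i) = j"
      using s zero[OF s] by (subst sum_short[symmetric]; auto simp: multiplicities_def)+
    thus "?res s \<in> bell_exponents r j"
      unfolding bell_exponents_def m_def[symmetric] by simp
  qed
  finally show ?thesis
    by (simp add: sum_distrib_left)
qed

text \<open>
  For \<open>r \<ge> 1\<close> the number of parts of a partition of \<open>r\<close> lies in \<open>{1..r}\<close>, so grouping the partitions
  by it gives the sum over \<open>j\<close>.
\<close>
lemma sum_partial_bell: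
  fixes x :: "nat \<Rightarrow> 'a :: field_char_0"
  assumes "r \<ge> 1"
  shows "(\<Sum>j=1..r. y ^ j * partial_bell r j x)
           = fact r * weighted_partitions (\<lambda>i. y * x i / fact i) r"
proof -
  let ?w = "\<lambda>s. \<Prod>i=1..r. (y * x i / fact i) ^ s i / fact (s i)"
  have "(\<Sum>i=1..r. s i) \<in> {1..r}" if "s \<in> multiplicities r" for s
  proof -
    have "(\<Sum>i=1..r. s i) \<noteq> 0"
    proof
      assume "(\<Sum>i=1..r. s i) = 0"
      hence "(\<Sum>i=1..r. i * s i) = 0"
        by auto
      thus False using that assms by (auto simp: multiplicities_def)
    qed
    moreover have "(\<Sum>i=1..r. s i) \<le> (\<Sum>i=1..r. i * s i)"
      by (intro sum_mono) auto
    moreover have "(\<Sum>i=1..r. i * s i) = r"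
      using that by (simp add: multiplicities_def)
    ultimately show ?thesis
      unfolding atLeastAtMost_iff by linarith
  qed
  hence "weighted_partitions (\<lambda>i. y * x i / fact i) r
          = (\<Sum>j=1..r. \<Sum>s | s \<in> multiplicities r \<and> (\<Sum>i=1..r. s i) = j. ?w s)"
    unfolding weighted_partitions_def
    by (intro sum.group[symmetric]) (auto simp: finite_multiplicities)
  thus ?thesis
    by (simp add: partial_bell_as_multiplicities sum_distrib_left)
qed

section \<open>The differential equation\<close>

text \<open>
  The coefficient form of \<open>t * X'(t) = 1 - (1 - N t)^(1/N)\<close>: in \<open>N^l * (1/N gchoose l)\<close> the product
  \<open>\<Prod>s<l. 1/N - s\<close> becomes \<open>\<Prod>s<l. 1 - N * s\<close>, whose factor for \<open>s = 0\<close> is \<open>1\<close> and whose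
  other \<open>l - 1\<close> factors are those of \<^const>\<open>bell_arg\<close> up to sign.
\<close>
lemma bell_arg_gbinomial:
  assumes "N > 0" "l \<ge> 1"
  shows "of_nat l * bell_arg (int N) l / fact l
           = - ((-1) ^ l * of_nat N ^ l * ((1 / of_nat N) gchoose l))"
proof -
  have "of_nat N ^ l * (\<Prod>s=0..<l. 1 / of_nat N - of_nat s)
      = (\<Prod>s=0..<l. of_nat N * (1 / of_nat N - of_nat s) :: rat)"
    by (subst prod.distrib) simp
  also have "\<dots> = (\<Prod>s=0..<l. 1 - of_nat N * of_nat s)"
    using assms(1) by (intro prod.cong) (auto simp: field_simps)
  also have "\<dots> = (\<Prod>s=1..<l. 1 - of_nat N * of_nat s)"
    using assms(2) by (subst prod.atLeast_Suc_lessThan) auto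
  also have "\<dots> = (\<Prod>s=1..<l. (-1) * (of_nat N * of_nat s - 1))"
    by (intro prod.cong) auto
  also have "\<dots> = (-1) ^ (l - 1) * (\<Prod>s=1..<l. of_nat N * of_nat s - 1)"
    by (subst prod.distrib) simp
  finally have "of_nat N ^ l * ((1 / of_nat N) gchoose l)
      = (-1) ^ (l - 1) * (\<Prod>s=1..<l. of_nat N * of_nat s - 1) / (fact l :: rat)"
    by (simp add: gbinomial_prod_rev)
  moreover have "(-1) ^ l * (-1) ^ (l - 1) = (-1 :: rat)"
    using assms(2) by (cases l) (auto simp flip: power_mult_distrib)
  ultimately have "(-1) ^ l * (of_nat N ^ l * ((1 / of_nat N) gchoose l))
      = - (\<Prod>s=1..<l. of_nat N * of_nat s - 1) / (fact l :: rat)"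
    by (metis (no_types, lifting) mult.assoc mult_minus1 times_divide_eq_right)
  thus ?thesis
    using assms(2) by (simp add: bell_arg_def mult.assoc)
qed

text \<open>
  The hypothesis says \<open>t * F' = c * (H - 1) * F\<close> for the binomial series \<open>H = (1 + N t)^(1/N)\<close>.
  Thus \<open>t * F' + c * F = c * H * F\<close>, and the \<open>N\<close>-th power turns \<open>H\<close> into a polynomial.
\<close>
lemma fps_root_ode_power:
  fixes F :: "'a :: field_char_0 fps"
  assumes N: "N > 0"
  assumes rec: "\<And>m. of_nat m * F $ m
      = c * (\<Sum>i=1..m. of_nat N ^ i * ((1 / of_nat N) gchoose i) * F $ (m - i))"
  shows "(fps_X * fps_deriv F + fps_const c * F) ^ N
           = fps_const (c ^ N) * (1 + fps_const (of_nat N) * fps_X) * F ^ N"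
proof -
  define H where "H = (fps_binomial (1 / of_nat N) :: 'a fps) oo (fps_const (of_nat N) * fps_X)"
  have H_nth: "H $ i = of_nat N ^ i * ((1 / of_nat N) gchoose i)" for i
    by (simp add: H_def fps_compose_linear)
  have "H ^ N = fps_binomial 1 oo (fps_const (of_nat N) * fps_X)"
    using N by (simp add: H_def fps_compose_power fps_binomial_power)
  also have "\<dots> = 1 + fps_const (of_nat N) * fps_X"
    by (simp add: fps_binomial_1 fps_compose_add_distrib)
  finally have H_power: "H ^ N = 1 + fps_const (of_nat N) * fps_X" .
  have "fps_X * fps_deriv F + fps_const c * F = fps_const c * (H * F)"
  proof (rule fps_ext)
    fix m
    have "(H * F) $ m = F $ m + (\<Sum>i=1..m. of_nat N ^ i * ((1 / of_nat N) gchoose i) * F $ (m - i))"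
      by (simp add: fps_mult_nth H_nth sum.atLeast_Suc_atMost)
    moreover have "(fps_X * fps_deriv F) $ m = of_nat m * F $ m"
      by (cases m) simp_all
    ultimately show "(fps_X * fps_deriv F + fps_const c * F) $ m = (fps_const c * (H * F)) $ m"
      by (simp add: rec distrib_left)
  qed
  thus ?thesis
    by (simp add: power_mult_distrib H_power mult_ac)
qed

section \<open>Nonnegative solutions are entire\<close>

lemma fps_mult_nonneg:
  fixes A B :: "'a :: linordered_idom fps"
  assumes "\<And>k. A $ k \<ge> 0" "\<And>k. B $ k \<ge> 0"
  shows "(A * B) $ m \<ge> 0"
  using assms by (auto simp: fps_mult_nth intro!: sum_nonneg)

lemma fps_power_nonneg:
  fixes A :: "'a :: linordered_idom fps"
  assumes "\<And>k. A $ k \<ge> 0"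
  shows "(A ^ N) $ m \<ge> 0"
  using assms by (induction N arbitrary: m) (auto intro!: fps_mult_nonneg)

text \<open>
  The first two terms of the binomial expansion of \<open>(A + B)^(k+1)\<close> by powers of \<open>A\<close>; the remaining
  terms have nonnegative coefficients.
\<close>
lemma fps_bernoulli_inequality:
  fixes A B :: "'a :: linordered_idom fps"
  assumes A: "\<And>k. A $ k \<ge> 0" and B: "\<And>k. B $ k \<ge> 0"
  shows "((A + B) ^ Suc k) $ m \<ge> (B ^ Suc k + of_nat (Suc k) * (A * B ^ k)) $ m"
proof (induction k arbitrary: m)
  case (Suc k)
  define D where "D = (A + B) ^ Suc k - (B ^ Suc k + of_nat (Suc k) * (A * B ^ k))"
  have "(A + B) ^ Suc (Suc k) - (B ^ Suc (Suc k) + of_nat (Suc (Suc k)) * (A * B ^ Suc k))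
      = (A + B) * D + of_nat (Suc k) * (A * (A * B ^ k))"
    by (simp add: D_def algebra_simps)
  moreover have "((A + B) * D) $ m \<ge> 0"
    using Suc.IH A B by (intro fps_mult_nonneg) (auto simp: D_def)
  moreover have "(of_nat (Suc k) * (A * (A * B ^ k))) $ m \<ge> 0"
    using A B by (intro fps_mult_nonneg fps_power_nonneg) (auto simp: fps_of_nat[symmetric] simp del: of_nat_Suc)
  ultimately show ?case
    by (metis add_nonneg_nonneg diff_ge_0_iff_ge fps_add_nth fps_sub_nth)
qed simp

text \<open>
  Multiplication by \<open>1 + N t\<close> on the right of the equation only involves \<open>u\<^sub>m\<close> and \<open>u\<^sub>m\<^sub>-\<^sub>1\<close>, where
  \<open>u\<close> are the coefficients of \<open>F^N\<close>, while the Euler operator \<open>t * d/dt\<close> on the left multiplies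
  coefficients by their index. After the terms \<open>c^N * u\<^sub>m\<close> cancel, this forces \<open>u\<^sub>m\<close> to decay like
  those of an exponential series. Nonnegativity is what allows the left side to be replaced by
  its part that is at most linear in \<open>t * F'\<close>.
\<close>
lemma nonneg_solution_bound:
  fixes F :: "'a :: linordered_field fps"
  assumes N: "N > 0" and c: "c > 0" and nonneg: "\<And>m. F $ m \<ge> 0" and F0: "F $ 0 = 1"
  assumes eq: "(fps_X * fps_deriv F + fps_const c * F) ^ N
           = fps_const (c ^ N) * (1 + fps_const (of_nat N) * fps_X) * F ^ N"
  shows "F $ m \<le> (of_nat N * c) ^ m / fact m"
proof -
  obtain k where k: "N = Suc k"
    using N by (cases N) auto
  define U where "U = F ^ N"
  have "fps_deriv U = of_nat N * fps_deriv F * F ^ k"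
    unfolding U_def k fps_deriv_power by (simp add: fps_of_nat del: power_Suc of_nat_Suc)
  hence lin: "of_nat N * (fps_X * fps_deriv F * (fps_const c * F) ^ k)
      = fps_const (c ^ k) * (fps_X * fps_deriv U)"
    by (simp add: power_mult_distrib mult_ac)
  have step: "of_nat (Suc m) * U $ Suc m \<le> of_nat N * c * U $ m" for m
  proof -
    have "((fps_const c * F) ^ N + of_nat N * (fps_X * fps_deriv F * (fps_const c * F) ^ k)) $ Suc m
       \<le> ((fps_X * fps_deriv F + fps_const c * F) ^ N) $ Suc m"
      unfolding k
    proof (rule fps_bernoulli_inequality)
      show "(fps_X * fps_deriv F) $ i \<ge> 0" for i
        using nonneg by (cases i) auto
    qed (use nonneg c in auto)
    also have "\<dots> = c ^ N * (U $ Suc m + of_nat N * U $ m)"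
      by (simp add: eq U_def[symmetric] mult.assoc distrib_right)
    also have "((fps_const c * F) ^ N + of_nat N * (fps_X * fps_deriv F * (fps_const c * F) ^ k)) $ Suc m
      = c ^ N * U $ Suc m + c ^ k * (of_nat (Suc m) * U $ Suc m)"
      unfolding lin by (simp add: power_mult_distrib U_def[symmetric])
    finally have "c ^ k * (of_nat (Suc m) * U $ Suc m) \<le> c ^ k * (of_nat N * c * U $ m)"
      by (simp add: k algebra_simps)
    thus ?thesis
      using c by simp
  qed
  have U: "U $ m \<le> (of_nat N * c) ^ m / fact m" for m
  proof (induction m)
    case 0
    show ?case by (simp add: U_def F0 fps_nth_power_0)
  next
    case (Suc m)
    have "of_nat (Suc m) * U $ Suc m \<le> of_nat N * c * ((of_nat N * c) ^ m / fact m)"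
      using step[of m] mult_left_mono[OF Suc.IH, of "of_nat N * c"] c by simp
    thus ?case
      by (simp add: field_simps del: of_nat_Suc)
  qed
  \<comment> \<open>\<open>F $ m\<close> is one of the nonnegative summands of the coefficient \<open>U $ m\<close> of \<open>F * F ^ k\<close>.\<close>
  have "F $ m = (F $ m) * (F ^ k) $ 0"
    by (simp add: F0 fps_nth_power_0)
  also have "\<dots> \<le> U $ m"
    unfolding U_def k power_Suc fps_mult_nth
    using nonneg fps_power_nonneg[of F]
      member_le_sum[of m "{0..m}" "\<lambda>i. F $ i * (F ^ k) $ (m - i)"] by simp
  finally show ?thesis
    using U[of m] by simp
qed

section \<open>Entire solutions do not exist\<close>

lemma fps_conv_radius_infinity_if_exp_bound:
  fixes F :: "complex fps"
  assumes "\<And>m. norm (F $ m) \<le> K ^ m / fact m"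
  shows "fps_conv_radius F = \<infinity>"
proof -
  have "conv_radius (fps_nth F) \<ge> \<infinity>"
  proof (rule conv_radius_geI_ex')
    fix \<rho> :: real assume "\<rho> > 0"
    show "summable (\<lambda>m. fps_nth F m * of_real \<rho> ^ m)"
    proof (rule summable_comparison_test)
      show "summable (\<lambda>m. inverse (fact m) * (K * \<rho>) ^ m)"
        by (rule summable_exp)
      show "\<exists>M. \<forall>m\<ge>M. norm (F $ m * of_real \<rho> ^ m) \<le> inverse (fact m) * (K * \<rho>) ^ m"
        using mult_right_mono[OF assms, of "\<rho> ^ _"] \<open>\<rho> > 0\<close>
        by (auto simp: norm_mult norm_power power_mult_distrib divide_inverse mult_ac)
    qed
  qed
  thus ?thesis
    by (simp add: fps_conv_radius_def)
qed

text \<open>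
  The order of vanishing at \<open>a\<close> is a multiple of \<open>N\<close> for \<open>P^N\<close> and for \<open>G^N\<close>, but the linear factor
  contributes \<open>1\<close>: a linear function has no meromorphic \<open>N\<close>-th root. The point \<open>z0\<close> ensures that
  \<open>G\<close> is not identically zero, so that its order at \<open>a\<close> is finite.
\<close>
lemma no_entire_power_times_linear:
  fixes P G :: "complex \<Rightarrow> complex"
  assumes N: "N \<ge> 2" and b: "b \<noteq> 0"
  assumes P: "P holomorphic_on UNIV" and G: "G holomorphic_on UNIV" and G0: "G z0 \<noteq> 0"
  assumes eq: "\<And>z. P z ^ N = b * (z - a) * G z ^ N"
  shows False
proof -
  have an: "P analytic_on {a}" "G analytic_on {a}"
    using P G by (auto intro: analytic_on_subset simp: analytic_on_open[symmetric] analytic_on_holomorphic)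
  have ev_G: "eventually (\<lambda>z. G z \<noteq> 0) (at a)"
    using non_zero_neighbour_alt[OF G, of a z0] G0 by (auto elim: eventually_mono)
  have ev_lin: "eventually (\<lambda>z. z \<noteq> a) (at a)"
    by (auto simp: eventually_at_filter)
  have ev_P: "eventually (\<lambda>z. P z \<noteq> 0) (at a)"
    using ev_G ev_lin
  proof eventually_elim
    case (elim z)
    hence "P z ^ N \<noteq> 0" using b by (simp add: eq)
    thus ?case using N by auto
  qed
  have "zorder (\<lambda>z. P z ^ N) a = N * zorder P a"
    using an ev_P by (intro zorder_power) (auto intro: analytic_on_imp_meromorphic_on eventually_frequently)
  moreover have "zorder (\<lambda>z. G z ^ N) a = N * zorder G a"
    using an ev_G by (intro zorder_power) (auto intro: analytic_on_imp_meromorphic_on eventually_frequently)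
  moreover have "zorder (\<lambda>z. b * (z - a)) a = 1"
    using b by (intro zorder_eqI[where S = UNIV and g = "\<lambda>_. b"]) auto
  moreover have "zorder (\<lambda>z. b * (z - a) * G z ^ N) a
      = zorder (\<lambda>z. b * (z - a)) a + zorder (\<lambda>z. G z ^ N) a"
  proof (rule zorder_times_analytic)
    show "eventually (\<lambda>z. b * (z - a) * G z ^ N \<noteq> 0) (at a)"
      using ev_G ev_lin by eventually_elim (use b in auto)
  qed (use an in \<open>auto intro!: analytic_intros\<close>)
  ultimately have "int N * (zorder P a - zorder G a) = 1"
    by (simp add: eq algebra_simps)
  thus False
    using N by (simp add: zmult_eq_1_iff)
qed

lemma no_entire_solution:
  fixes F :: "complex fps"
  assumes N: "N \<ge> 2" and c: "c \<noteq> 0" and F0: "F $ 0 = 1"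
    and bound: "\<And>m. norm (F $ m) \<le> K ^ m / fact m"
  assumes eq: "(fps_X * fps_deriv F + fps_const c * F) ^ N
           = fps_const (c ^ N) * (1 + fps_const (of_nat N) * fps_X) * F ^ N"
  shows False
proof -
  define P where "P = fps_X * fps_deriv F + fps_const c * F"
  have F: "fps_conv_radius F = \<infinity>"
    using bound by (rule fps_conv_radius_infinity_if_exp_bound)
  hence "fps_conv_radius (fps_deriv F) = \<infinity>"
    using fps_conv_radius_deriv[of F] by simp
  with F have P: "fps_conv_radius P = \<infinity>"
    using fps_conv_radius_add[of "fps_X * fps_deriv F" "fps_const c * F"]
      fps_conv_radius_mult[of fps_X "fps_deriv F"] fps_conv_radius_mult[of "fps_const c" F]
    by (simp add: P_def)
  have lin: "fps_const (c ^ N) * (1 + fps_const (of_nat N) * fps_X)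
      = fps_of_poly [:c ^ N, c ^ N * of_nat N:]"
    by (simp add: fps_of_poly_pCons algebra_simps)
  show False
  proof (rule no_entire_power_times_linear[where P = "eval_fps P" and G = "eval_fps F" and N = N
        and a = "- 1 / of_nat N" and b = "c ^ N * of_nat N" and ?z0.0 = 0])
    show "eval_fps P holomorphic_on UNIV" "eval_fps F holomorphic_on UNIV"
      by (intro holomorphic_on_eval_fps; simp add: P F)+
    show "eval_fps F 0 \<noteq> 0"
      by (simp add: eval_fps_at_0 F0)
    show "eval_fps P z ^ N = c ^ N * of_nat N * (z - (- 1 / of_nat N)) * eval_fps F z ^ N" for z
    proof -
      have "eval_fps P z ^ N = eval_fps (P ^ N) z"
        by (simp add: eval_fps_power P)
      also have "P ^ N = fps_of_poly [:c ^ N, c ^ N * of_nat N:] * F ^ N"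
        unfolding P_def eq lin ..
      also have "eval_fps \<dots> z = (c ^ N + z * (c ^ N * of_nat N)) * eval_fps F z ^ N"
        using F fps_conv_radius_power[of F N] by (simp add: eval_fps_mult eval_fps_power)
      finally show ?thesis
        using N by (simp add: field_simps)
    qed
  qed (use N c in auto)
qed

section \<open>Negative coefficients\<close>

lemma of_rat_fact: "(of_rat (fact k) :: 'a :: field_char_0) = fact k"
  by (metis of_nat_fact of_rat_of_nat_eq)

lemma of_rat_gbinomial: "(of_rat (a gchoose k) :: 'a :: field_char_0) = of_rat a gchoose k"
  by (simp add: gbinomial_prod_rev of_rat_divide of_rat_prod of_rat_diff of_rat_fact)

lemma norm_of_rat: "norm (of_rat x :: complex) = of_rat \<bar>x\<bar>"
proof -
  obtain a b where "x = of_int a / of_int b"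
    by (metis Fract_of_int_quotient Rat_cases)
  thus ?thesis
    by (simp add: of_rat_divide norm_divide abs_divide flip: of_int_abs)
qed

text \<open>
  The coefficients \<open>g\<close> are studied twice: as a rational series, where the order gives the growth
  bound, and as a complex series, where the bound makes the sum an entire function. Both are instances
  of \<open>fps_root_ode_power\<close>, because \<^const>\<open>of_rat\<close> carries the recurrence over.
\<close>
theorem theorem2:
  fixes n :: int and q :: rat
  assumes "n \<ge> 2" and "q > 0"
  shows "\<exists>r::nat. r \<ge> 1 \<and>
    (-1) ^ r * (\<Sum>j=1..r. (- q) ^ j * partial_bell r j (bell_arg n)) < 0"
proof (rule ccontr)
  assume contra: "\<not> ?thesis"
  define N where "N = nat n"
  have N: "N \<ge> 2" "n = int N"
    using assms(1) by (auto simp: N_def)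
  define c where "c = (\<lambda>i. (- q) * bell_arg n i / fact i)"
  define g where "g = (\<lambda>r. (-1) ^ r * weighted_partitions c r)"
  have g0: "g 0 = 1"
    by (simp add: g_def weighted_partitions_0)
  have g_nonneg: "g r \<ge> 0" for r
  proof (cases "r = 0")
    case False
    hence "r \<ge> 1"
      by simp
    hence "fact r * g r = (-1) ^ r * (\<Sum>j=1..r. (- q) ^ j * partial_bell r j (bell_arg n))"
      by (subst sum_partial_bell) (simp_all only: g_def c_def mult.left_commute)
    also have "\<dots> \<ge> 0"
      using contra \<open>r \<ge> 1\<close> by (meson not_less)
    finally have "fact r * g r \<ge> 0" .
    thus ?thesis
      using fact_gt_zero[of r, where 'a = rat] by (simp only: zero_le_mult_iff) linarith
  qed (simp add: g0)
  have rec: "of_nat m * g m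
      = q * (\<Sum>i=1..m. of_nat N ^ i * ((1 / of_nat N) gchoose i) * g (m - i))" for m
  proof -
    have "of_nat m * g m = (-1) ^ m * (\<Sum>i=1..m. of_nat i * c i * weighted_partitions c (m - i))"
      by (simp add: g_def weighted_partitions_rec mult.left_commute)
    also have "\<dots> = (\<Sum>i=1..m. q * (of_nat N ^ i * ((1 / of_nat N) gchoose i) * g (m - i)))"
      unfolding sum_distrib_left
    proof (rule sum.cong)
      fix i assume i: "i \<in> {1..m}"
      have "of_nat i * c i = - q * (of_nat i * bell_arg (int N) i / fact i)"
        by (simp add: c_def N)
      also have "\<dots> = q * ((-1) ^ i * of_nat N ^ i * ((1 / of_nat N) gchoose i))"
        using i N by (subst bell_arg_gbinomial) auto
      finally have "of_nat i * c i = q * ((-1) ^ i * of_nat N ^ i * ((1 / of_nat N) gchoose i))" .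
      \<comment> \<open>The sign of \<open>i * c i\<close> turns \<open>(-1) ^ m\<close> into the sign in \<open>g (m - i)\<close>.\<close>
      moreover have "(-1) ^ m * (-1) ^ i = ((-1) ^ (m - i) :: rat)"
        using i by (auto simp: minus_one_power_iff)
      ultimately show "(-1) ^ m * (of_nat i * c i * weighted_partitions c (m - i))
          = q * (of_nat N ^ i * ((1 / of_nat N) gchoose i) * g (m - i))"
        by (simp add: g_def mult_ac)
    qed simp
    finally show ?thesis
      by (simp add: sum_distrib_left)
  qed
  have bound: "g m \<le> (of_nat N * q) ^ m / fact m" for m
  proof -
    have "Abs_fps g $ m \<le> (of_nat N * q) ^ m / fact m"
      by (rule nonneg_solution_bound[OF _ _ _ _ fps_root_ode_power])
         (use N assms g0 g_nonneg rec in auto)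
    thus ?thesis by simp
  qed
  show False
  proof (rule no_entire_solution[OF _ _ _ _ fps_root_ode_power])
    show "norm (Abs_fps (\<lambda>m. of_rat (g m) :: complex) $ m) \<le> of_rat (of_nat N * q) ^ m / fact m" for m
    proof -
      have "norm (of_rat (g m) :: complex) = of_rat (g m)"
        using g_nonneg[of m] by (simp add: norm_of_rat)
      also have "\<dots> \<le> of_rat ((of_nat N * q) ^ m / fact m)"
        by (simp only: of_rat_less_eq bound)
      finally show ?thesis
        by (simp add: of_rat_divide of_rat_power of_rat_mult of_rat_fact)
    qed
    show "of_nat m * Abs_fps (\<lambda>m. of_rat (g m) :: complex) $ m
        = of_rat q * (\<Sum>i=1..m. of_nat N ^ i * ((1 / of_nat N) gchoose i)
            * Abs_fps (\<lambda>m. of_rat (g m)) $ (m - i))" for m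
      using arg_cong[OF rec[of m], of "of_rat :: rat \<Rightarrow> complex"]
      by (simp add: of_rat_mult of_rat_sum of_rat_power of_rat_gbinomial of_rat_divide)
  qed (use N assms g0 in auto)
qed

end
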